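(* Let $d\ge2$, $\Lambda$ a full rank lattice in $\mathbb{R}^d$ of covolume $1$, $\Lambda^\ast$ its dual lattice, and $f(\boldsymbol\tau)=|\boldsymbol\tau|_+$. Then for each $k\in\{1,\dots,d\}$ the exponents $\underline{\psi}_k(\Lambda,f)$ and $\overline{\psi}_{d+1-k}(\Lambda^\ast,f)$ have different signs, or are simultaneously zero. Moreover, \[ |\underline{\psi}_k(\Lambda,f)|\le(d-1)|\overline{\psi}_{d+1-k}(\Lambda^\ast,f)|,\qquad |\overline{\psi}_k(\Lambda,f)|\le(d-1)|\underline{\psi}_{d+1-k}(\Lambda^\ast,f)|. \]
   Context: $\mathcal T=\{\boldsymbol\tau\in\mathbb{R}^d:\sum\tau_i=0\}$, $|\boldsymbol\tau|_+=\max_i\tau_i$, $|\cdot|$ the supremum norm. $\mathcal B_{\boldsymbol\tau}=\mathrm{diag}(e^{\tau_1},\dots,e^{\tau_d})\{\mathbf z:|\mathbf z|\le1\}$, $L_k(M,\boldsymbol\tau)=\log\lambda_k(\mathcal B_{\boldsymbol\tau},M)$ with $\lambda_k$ the $k$-th successive minimum of the lattice $M$. $\underline{\psi}_k(M,f)=\liminf_{|\boldsymbol\tau|\to\infty}L_k(M,\boldsymbol\tau)/f(\boldsymbol\tau)$ and $\overline{\psi}_k(M,f)=\limsup_{|\boldsymbol\tau|\to\infty}L_k(M,\boldsymbol\tau)/f(\boldsymbol\tau)$, $\boldsymbol\tau\in\mathcal T$. *)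

theory Defs
  imports "HOL-Analysis.Analysis"
begin

definition lattice_basis :: "real^'n^'n \<Rightarrow> (real^'n) set \<Rightarrow> bool" where
  "lattice_basis A M \<longleftrightarrow> invertible A \<and> M = {A *v z | z. \<forall>i. z $ i \<in> \<int>}"

definition full_rank_lattice :: "(real^'n) set \<Rightarrow> bool" where
  "full_rank_lattice M \<longleftrightarrow> (\<exists>A. lattice_basis A M)"

definition covolume :: "(real^'n) set \<Rightarrow> real" where
  "covolume M = (THE c. \<exists>A. lattice_basis A M \<and> c = \<bar>det A\<bar>)"

definition dual_lattice :: "(real^'n) set \<Rightarrow> (real^'n) set" where
  "dual_lattice M = {y. \<forall>x\<in>M. x \<bullet> y \<in> \<int>}"

definition successive_minimum :: "nat \<Rightarrow> (real^'n) set \<Rightarrow> (real^'n) set \<Rightarrow> real" where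
  "successive_minimum k B M =
     Inf {r. r > 0 \<and> (\<exists>S. S \<subseteq> (\<lambda>x. r *\<^sub>R x) ` B \<inter> M \<and> independent S \<and> card S = k)}"

definition trace_zero :: "(real^'n) set" where
  "trace_zero = {\<tau>. (\<Sum>i\<in>UNIV. \<tau> $ i) = 0}"

definition max_coord :: "real^'n \<Rightarrow> real" where
  "max_coord \<tau> = Max (range (\<lambda>i. \<tau> $ i))"

definition diag_exp :: "real^'n \<Rightarrow> real^'n^'n" where
  "diag_exp \<tau> = (\<chi> i j. if i = j then exp (\<tau> $ i) else 0)"

definition box_at :: "real^'n \<Rightarrow> (real^'n) set" where
  "box_at \<tau> = (\<lambda>z. diag_exp \<tau> *v z) ` {z. infnorm z \<le> 1}"

definition log_min :: "nat \<Rightarrow> (real^'n) set \<Rightarrow> real^'n \<Rightarrow> real" where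
  "log_min k M \<tau> = ln (successive_minimum k (box_at \<tau>) M)"

definition trace_zero_at_infinity :: "(real^'n) filter" where
  "trace_zero_at_infinity = inf (filtercomap infnorm at_top) (principal trace_zero)"

definition lower_exponent :: "nat \<Rightarrow> (real^'n) set \<Rightarrow> (real^'n \<Rightarrow> real) \<Rightarrow> ereal" where
  "lower_exponent k M f =
     Liminf trace_zero_at_infinity (\<lambda>\<tau>. ereal (log_min k M \<tau> / f \<tau>))"

definition upper_exponent :: "nat \<Rightarrow> (real^'n) set \<Rightarrow> (real^'n \<Rightarrow> real) \<Rightarrow> ereal" where
  "upper_exponent k M f =
     Limsup trace_zero_at_infinity (\<lambda>\<tau>. ereal (log_min k M \<tau> / f \<tau>))"

lemma lattice_basis_dvd:
  fixes A B :: "real^'n^'n"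
  assumes A: "lattice_basis A M" and B: "lattice_basis B M"
  obtains c where "c \<in> \<int>" "det B = det A * c"
proof -
  have "\<exists>z. (\<forall>i. z $ i \<in> \<int>) \<and> column j B = A *v z" for j
  proof -
    have "B *v axis j 1 \<in> M"
      using B unfolding lattice_basis_def by (auto simp: axis_def intro!: exI[of _ "axis j 1"])
    then show ?thesis
      using A by (auto simp: lattice_basis_def matrix_vector_mult_basis)
  qed
  then obtain Z where Z: "\<And>j i. Z j $ i \<in> \<int>" "\<And>j. column j B = A *v Z j"
    by metis
  define U :: "real^'n^'n" where "U = (\<chi> i j. Z j $ i)"
  have "B = A ** U"
    using Z(2) by (simp add: vec_eq_iff column_def matrix_matrix_mult_def
        matrix_vector_mult_def U_def)
  then have "det B = det A * det U"
    by (simp add: det_mul)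
  moreover have "det U \<in> \<int>"
    unfolding det_def U_def using Z(1)
    by (auto intro!: Ints_sum Ints_mult Ints_prod)
  ultimately show ?thesis
    using that by blast
qed

lemma covolume_eq:
  fixes A :: "real^'n^'n"
  assumes A: "lattice_basis A M"
  shows "covolume M = \<bar>det A\<bar>"
proof -
  have le: "\<bar>det P\<bar> \<le> \<bar>det Q\<bar>"
    if P: "lattice_basis P M" and Q: "lattice_basis Q M" for P Q :: "real^'n^'n"
  proof -
    obtain c where c: "c \<in> \<int>" "det Q = det P * c"
      using lattice_basis_dvd[OF P Q] .
    have "det Q \<noteq> 0"
      using Q by (simp add: lattice_basis_def invertible_det_nz)
    then have "1 \<le> \<bar>c\<bar>"
      using c by (intro Ints_nonzero_abs_ge1) auto
    then have "\<bar>det P\<bar> * 1 \<le> \<bar>det P\<bar> * \<bar>c\<bar>"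
      by (rule mult_left_mono) simp
    then show ?thesis
      using c(2) by (simp add: abs_mult)
  qed
  show ?thesis
    unfolding covolume_def
    using A le by (intro the_equality) (auto intro: antisym)
qed

end

theory Submission
  imports Defs
begin

text \<open>
  Everything rests on the transference estimate
  $L_k(\Lambda,\tau) + L_{d+1-k}(\Lambda^*,-\tau) = O(1)$, uniformly in $\tau$.

  For its upper half, rescale $\Lambda$ by $e^{-\tau}$ and take a lattice basis $B$ with
  $|b|\,|b^*| \le C_d$, where $b^*$ denotes the dual basis. If $r$ is too small for the $k$-th
  minimum, then fewer than $k$ elements of $B$ have norm at most $r$, so at least $d+1-k$ dual
  vectors have norm at most $C_d/r$. Such a basis is built by induction on the dimension:
  project along an almost shortest vector $v$, and lift a good basis of the projected lattice with
  coefficients of size at most $1/2$ in the direction $v$. For the lower half, $k$ independent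
  vectors of $\Lambda$ and $d+1-k$ of $\Lambda^*$ cannot be mutually orthogonal, so some inner
  product is a nonzero integer.

  On the trace-zero hyperplane $|\tau|_+$ and $|{-\tau}|_+$ differ by a factor of at most $d-1$,
  so the two normalised logarithms differ, up to sign and $o(1)$, by a factor in
  $[1/(d-1), d-1]$; this preserves the signs of upper limits and their sizes up to $d-1$.
\<close>

subsection \<open>Reduced bases of discrete subgroups\<close>

text \<open>For finite \<open>B\<close> without 0 this says that the coordinate functional of each
  \<open>b\<close> has norm at most \<open>C / norm b\<close> on the span of \<open>B\<close>. It is
  the bound on the product of the norms of \<open>b\<close> and its dual vector, phrased without a
  dual basis, so that it also makes sense when \<open>B\<close> does not span the space.\<close>

definition well_conditioned :: "real \<Rightarrow> 'a::real_normed_vector set \<Rightarrow> bool" where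
  "well_conditioned C B \<longleftrightarrow>
     (\<forall>c. \<forall>b\<in>B. \<bar>c b\<bar> * norm b \<le> C * norm (\<Sum>b\<in>B. c b *\<^sub>R b))"

text \<open>Discreteness is encoded as a positive lower bound for the norms of nonzero elements;
  this is the form that is checked for a projected lattice and that gives a positive
  minimum.\<close>

definition discrete_subgroup :: "'a::real_normed_vector set \<Rightarrow> bool" where
  "discrete_subgroup L \<longleftrightarrow> 0 \<in> L \<and> (\<forall>x\<in>L. \<forall>y\<in>L. x - y \<in> L) \<and>
     (\<exists>e>0. \<forall>x\<in>L. x \<noteq> 0 \<longrightarrow> e \<le> norm x)"

definition integer_span :: "'a::real_vector set \<Rightarrow> 'a set" where
  "integer_span B = {\<Sum>b\<in>B. c b *\<^sub>R b | c. \<forall>b. c b \<in> \<int>}"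

lemma integer_span_empty: "integer_span {} = {0::'a::real_vector}"
proof -
  have "\<exists>c::'a \<Rightarrow> real. \<forall>b. c b \<in> \<int>" by (rule exI[of _ "\<lambda>_. 0"]) simp
  then show ?thesis by (simp add: integer_span_def)
qed

lemma well_conditioned_independent:
  assumes "finite B" "0 \<notin> B" "well_conditioned C B"
  shows "independent B"
proof (rule independent_if_scalars_zero[OF assms(1)])
  fix c b assume "(\<Sum>x\<in>B. c x *\<^sub>R x) = 0" "b \<in> B"
  then have "\<bar>c b\<bar> * norm b \<le> 0"
    using assms(3) unfolding well_conditioned_def by (metis mult_zero_right norm_zero)
  moreover have "norm b > 0" using \<open>b \<in> B\<close> assms(2) by auto
  ultimately show "c b = 0"
    by (simp add: mult_le_0_iff)
qed

section \<open>Closure properties of discrete subgroups\<close>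

lemma discrete_subgroup_diff:
  assumes "discrete_subgroup L" "x \<in> L" "y \<in> L"
  shows "x - y \<in> L"
  using assms unfolding discrete_subgroup_def by blast

lemma discrete_subgroup_zero: "discrete_subgroup L \<Longrightarrow> 0 \<in> L"
  by (simp add: discrete_subgroup_def)

lemma discrete_subgroup_uminus:
  assumes "discrete_subgroup L" "x \<in> L"
  shows "- x \<in> L"
  using discrete_subgroup_diff[OF assms(1) discrete_subgroup_zero assms(2)] assms(1) by simp

lemma discrete_subgroup_add:
  assumes "discrete_subgroup L" "x \<in> L" "y \<in> L"
  shows "x + y \<in> L"
  using discrete_subgroup_diff[OF assms(1,2) discrete_subgroup_uminus[OF assms(1,3)]] by simp

lemma discrete_subgroup_Ints_scale:
  assumes L: "discrete_subgroup L" and "x \<in> L" "c \<in> \<int>"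
  shows "c *\<^sub>R x \<in> L"
proof -
  have nat: "real n *\<^sub>R x \<in> L" for n
  proof (induction n)
    case 0
    then show ?case using L by (simp add: discrete_subgroup_def)
  next
    case (Suc n)
    then show ?case
      using discrete_subgroup_add[OF L \<open>x \<in> L\<close> Suc] by (simp add: algebra_simps)
  qed
  obtain z where z: "c = of_int z" using assms(3) by (auto elim: Ints_cases)
  show ?thesis
  proof (cases "z \<ge> 0")
    case True
    then show ?thesis using nat[of "nat z"] z by simp
  next
    case False
    then have "c *\<^sub>R x = - (real (nat (- z)) *\<^sub>R x)" using z by simp
    then show ?thesis using nat discrete_subgroup_uminus[OF L] by metis
  qed
qed

lemma discrete_subgroup_integer_span:
  assumes L: "discrete_subgroup L" and "finite B" "B \<subseteq> L"
  shows "integer_span B \<subseteq> L"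
proof
  fix x assume "x \<in> integer_span B"
  then obtain c where c: "\<And>b. c b \<in> \<int>" and x: "x = (\<Sum>b\<in>B. c b *\<^sub>R b)"
    by (auto simp: integer_span_def)
  have "(\<Sum>b\<in>A. c b *\<^sub>R b) \<in> L" if "finite A" "A \<subseteq> L" for A
    using that
  proof (induction A)
    case empty
    then show ?case using L by (simp add: discrete_subgroup_def)
  next
    case (insert b A)
    then have "c b *\<^sub>R b \<in> L" "(\<Sum>b\<in>A. c b *\<^sub>R b) \<in> L"
      using discrete_subgroup_Ints_scale[OF L _ c] by simp_all
    then show ?case using insert.hyps discrete_subgroup_add[OF L] by simp
  qed
  then show "x \<in> L" using assms x by simp
qed

text \<open>Taking \<open>m\<close> as the infimum of the nonzero norms avoids proving that it is
  attained. Any factor below 2 would make half of \<open>v\<close> shorter than \<open>m\<close>;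
  the value 3/2 leaves the margin \<open>m / 4\<close> used for projected vectors.\<close>

lemma almost_shortest_vector:
  assumes L: "discrete_subgroup L" and "L \<noteq> {0}"
  obtains v m where "v \<in> L" "v \<noteq> 0" "m > 0" "norm v < 3/2 * m"
    "\<And>x. x \<in> L \<Longrightarrow> x \<noteq> 0 \<Longrightarrow> m \<le> norm x"
proof -
  obtain e where e: "e > 0" "\<And>x. x \<in> L \<Longrightarrow> x \<noteq> 0 \<Longrightarrow> e \<le> norm x"
    using L unfolding discrete_subgroup_def by blast
  define N where "N = norm ` (L - {0})"
  have ne: "N \<noteq> {}" using L \<open>L \<noteq> {0}\<close> by (auto simp: N_def discrete_subgroup_def)
  define m where "m = Inf N"
  have "bdd_below N" unfolding N_def by (auto intro: bdd_belowI[of _ 0])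
  then have m: "m \<le> norm x" if "x \<in> L" "x \<noteq> 0" for x
    using that unfolding m_def N_def by (intro cInf_lower) auto
  have "e \<le> m" unfolding m_def using ne e(2) by (intro cInf_greatest) (auto simp: N_def)
  with e have "m > 0" by simp
  then have "Inf N < 3/2 * m" by (simp add: m_def)
  then obtain y where "y \<in> N" "y < 3/2 * m" using ne cInf_lessD by blast
  then show ?thesis using that \<open>m > 0\<close> m by (auto simp: N_def)
qed

text \<open>The quantifier order matters: \<open>C\<close> depends only on the ambient space and
  \<open>n\<close>, not on \<open>L\<close>. Applied to all rescalings of one lattice, this makes
  the transference constant independent of \<tau>.\<close>

lemma reduced_basis:
  "\<exists>C>0. \<forall>L::'a::euclidean_space set. discrete_subgroup L \<and> dim L \<le> n \<longrightarrow>
     (\<exists>B. finite B \<and> B \<subseteq> L \<and> 0 \<notin> B \<and> L \<subseteq> integer_span B \<and> well_conditioned C B)"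
proof (induction n)
  case 0
  show ?case
  proof (intro exI[of _ 1] conjI allI impI)
    fix L :: "'a set" assume "discrete_subgroup L \<and> dim L \<le> 0"
    then have "L \<subseteq> {0}" by (simp add: dim_eq_0)
    then show "\<exists>B. finite B \<and> B \<subseteq> L \<and> 0 \<notin> B \<and> L \<subseteq> integer_span B \<and> well_conditioned 1 B"
      by (intro exI[of _ "{}"]) (auto simp: integer_span_empty well_conditioned_def)
  qed simp
next
  case (Suc n)
  then obtain C where C: "C > 0" and IH: "\<And>L::'a set. discrete_subgroup L \<Longrightarrow> dim L \<le> n \<Longrightarrow>
     \<exists>B. finite B \<and> B \<subseteq> L \<and> 0 \<notin> B \<and> L \<subseteq> integer_span B \<and> well_conditioned C B"
    by blast
  \<comment> \<open>The new constant has to dominate \<open>4 * C\<close>, the loss for lifted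
    vectors, and \<open>1 + 4 * n * C\<close>, the bound for the new vector
    \<open>v\<close>.\<close>
  define C' where "C' = 1 + 4 * (real n + 1) * C"
  have "C' = 1 + real n * (4 * C) + 4 * C" by (simp add: C'_def algebra_simps)
  moreover have "0 \<le> real n * (4 * C)" using C by simp
  ultimately have C': "C' > 0" "4 * C \<le> C'" "1 + real n * (4 * C) \<le> C'"
    using C by linarith+
  have "\<exists>B. finite B \<and> B \<subseteq> L \<and> 0 \<notin> B \<and> L \<subseteq> integer_span B \<and> well_conditioned C' B"
    if L: "discrete_subgroup L" and dimL: "dim L \<le> Suc n" for L :: "'a set"
  proof (cases "L = {0}")
    case True
    then show ?thesis
      by (intro exI[of _ "{}"]) (simp add: integer_span_empty well_conditioned_def)
  next
    case False
    obtain v m where v: "v \<in> L" "v \<noteq> 0" and m: "m > 0" "norm v < 3/2 * m"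
      and short: "\<And>x. x \<in> L \<Longrightarrow> x \<noteq> 0 \<Longrightarrow> m \<le> norm x"
      using almost_shortest_vector[OF L False] by metis
    \<comment> \<open>\<open>q x\<close> is the coordinate of \<open>x\<close> along
      \<open>v\<close>, and \<pi> is the orthogonal projection onto the complement of
      \<open>v\<close>.\<close>
    define q where "q x = (v \<bullet> x) / (v \<bullet> v)" for x
    define \<pi> where "\<pi> x = x - q x *\<^sub>R v" for x
    have lin: "linear \<pi>"
      by (rule linearI) (simp_all add: \<pi>_def q_def inner_add_right add_divide_distrib algebra_simps)
    have orth: "v \<bullet> \<pi> x = 0" for x
      using v by (simp add: \<pi>_def q_def inner_diff_right)
    have \<pi>v: "\<pi> v = 0" using v by (simp add: \<pi>_def q_def)
    have norm_\<pi>: "norm (\<pi> x) \<le> norm x" for x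
    proof -
      have "x = \<pi> x + q x *\<^sub>R v" by (simp add: \<pi>_def)
      moreover have "orthogonal (\<pi> x) (q x *\<^sub>R v)"
        using orth[of x] by (simp add: orthogonal_def inner_commute)
      ultimately have "(norm x)\<^sup>2 = (norm (\<pi> x))\<^sup>2 + (norm (q x *\<^sub>R v))\<^sup>2"
        using norm_add_Pythagorean by metis
      then have "(norm (\<pi> x))\<^sup>2 \<le> (norm x)\<^sup>2" by simp
      then show ?thesis by (simp add: power2_le_iff_abs_le)
    qed
    \<comment> \<open>Subtracting the nearest integer multiple of \<open>v\<close> does not change
      the projection and leaves a component along \<open>v\<close> of size at most half of
      \<open>norm v\<close>.\<close>
    have lift: "\<exists>y k. y \<in> L \<and> \<pi> y = \<pi> x \<and> norm (y - \<pi> x) \<le> norm v / 2 \<and> k \<in> \<int> \<and> x = y + k *\<^sub>R v"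
      if "x \<in> L" for x
    proof -
      define k where "k = real_of_int (round (q x))"
      define y where "y = x - k *\<^sub>R v"
      have "y \<in> L" using discrete_subgroup_diff[OF L that discrete_subgroup_Ints_scale[OF L v(1), of k]]
        by (simp add: y_def k_def)
      moreover have "\<pi> y = \<pi> x" unfolding y_def
        using linear_diff[OF lin] linear_scale[OF lin] \<pi>v by simp
      moreover have "norm (y - \<pi> x) \<le> norm v / 2"
      proof -
        have "y - \<pi> x = (q x - k) *\<^sub>R v" by (simp add: y_def \<pi>_def algebra_simps)
        moreover have "\<bar>q x - k\<bar> \<le> 1/2"
          using of_int_round_abs_le[of "q x"] by (simp add: k_def abs_minus_commute)
        ultimately show ?thesis
          using mult_right_mono[of "\<bar>q x - k\<bar>" "1/2" "norm v"] by simp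
      qed
      moreover have "k \<in> \<int>" unfolding k_def by (rule Ints_of_int)
      moreover have "x = y + k *\<^sub>R v" unfolding y_def by (rule diff_add_cancel[symmetric])
      ultimately show ?thesis by (intro exI[of _ y] exI[of _ k] conjI)
    qed
    \<comment> \<open>The reduced representative of such an \<open>x\<close> has norm at most
      \<open>norm v / 2\<close>, which is below \<open>3/4 * m\<close>, so it is zero and only the
      multiple of \<open>v\<close> remains.\<close>
    have kernel: "\<exists>k\<in>\<int>. x = k *\<^sub>R v" if xL: "x \<in> L" and px: "\<pi> x = 0" for x
    proof -
      obtain y k where y: "y \<in> L" "norm (y - \<pi> x) \<le> norm v / 2" "k \<in> \<int>" "x = y + k *\<^sub>R v"
        using lift[OF xL] by metis
      then have "norm y < m" using px m by simp
      then have "y = 0" using short[OF y(1)] by linarith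
      then show ?thesis using y by auto
    qed
    \<comment> \<open>A reduced lift is nonzero, hence of norm at least \<open>m\<close>, and less
      than \<open>3/4 * m\<close> of this can come from the direction of \<open>v\<close>. This
      bound gives discreteness of the projected group and later controls the lifted basis.\<close>
    have proj_large: "m / 4 \<le> norm (\<pi> x)" if xL: "x \<in> L" and px: "\<pi> x \<noteq> 0" for x
    proof -
      obtain y where y: "y \<in> L" "\<pi> y = \<pi> x" "norm (y - \<pi> x) \<le> norm v / 2"
        using lift[OF xL] by blast
      have "y \<noteq> 0" using y(2) px linear_0[OF lin] by auto
      then have "m \<le> norm y" using short y by blast
      also have "\<dots> \<le> norm (y - \<pi> x) + norm (\<pi> x)" by norm
      finally show ?thesis using y(3) m by simp
    qed
    have disc: "discrete_subgroup (\<pi> ` L)"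
      unfolding discrete_subgroup_def
    proof (intro conjI ballI)
      show "0 \<in> \<pi> ` L" using \<pi>v v by force
      show "x - y \<in> \<pi> ` L" if xy: "x \<in> \<pi> ` L" "y \<in> \<pi> ` L" for x y
      proof -
        obtain x' y' where "x' \<in> L" "y' \<in> L" "x = \<pi> x'" "y = \<pi> y'" using xy by blast
        then show ?thesis
          using discrete_subgroup_diff[OF L] linear_diff[OF lin] by (metis image_eqI)
      qed
      show "\<exists>e>0. \<forall>x\<in>\<pi> ` L. x \<noteq> 0 \<longrightarrow> e \<le> norm x"
        using proj_large m by (intro exI[of _ "m/4"]) auto
    qed
    \<comment> \<open>The vector \<open>v\<close> lies in \<open>L\<close> but is orthogonal to the
      whole projection, so projecting lowers the dimension.\<close>
    have "dim (\<pi> ` L) \<le> n"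
    proof -
      have "v \<notin> span (\<pi> ` L)"
      proof
        assume "v \<in> span (\<pi> ` L)"
        moreover have "orthogonal v y" if "y \<in> \<pi> ` L" for y
          using that orth by (auto simp: orthogonal_def)
        ultimately have "orthogonal v v" by (rule orthogonal_to_span)
        then show False using v by (simp add: orthogonal_def)
      qed
      then have "dim (insert v (\<pi> ` L)) = dim (\<pi> ` L) + 1" by (simp add: dim_insert)
      moreover have "insert v (\<pi> ` L) \<subseteq> span L"
        using v(1) by (auto simp: \<pi>_def intro: span_diff span_scale span_base)
      then have "dim (insert v (\<pi> ` L)) \<le> dim L"
        using dim_subset dim_span by metis
      ultimately show ?thesis using dimL by simp
    qed
    then obtain P where P: "finite P" "P \<subseteq> \<pi> ` L" "0 \<notin> P" "\<pi> ` L \<subseteq> integer_span P"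
        "well_conditioned C P" and Pn: "dim (\<pi> ` L) \<le> n"
      using IH[OF disc] by blast
    have cardP: "card P \<le> n"
      using independent_card_le_dim[OF P(2) well_conditioned_independent[OF P(1,3,5)]] Pn by simp
    have "\<exists>y. y \<in> L \<and> \<pi> y = p \<and> norm (y - p) \<le> norm v / 2" if p: "p \<in> P" for p
    proof -
      obtain x where "x \<in> L" "p = \<pi> x" using p P(2) by auto
      then show ?thesis using lift[of x] by blast
    qed
    then obtain l where l: "\<And>p. p \<in> P \<Longrightarrow> l p \<in> L" "\<And>p. p \<in> P \<Longrightarrow> \<pi> (l p) = p"
      "\<And>p. p \<in> P \<Longrightarrow> norm (l p - p) \<le> norm v / 2"
      by metis
    have inj: "inj_on l P" using l(2) by (metis inj_onI)
    define B where "B = insert v (l ` P)"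
    have vl: "v \<notin> l ` P" using l(2) \<pi>v P(3) by force
    have sumB: "(\<Sum>b\<in>B. c b *\<^sub>R b) = c v *\<^sub>R v + (\<Sum>p\<in>P. c (l p) *\<^sub>R l p)" for c
      unfolding B_def using vl P(1) inj by (simp add: sum.reindex)
    show ?thesis
    proof (intro exI[of _ B] conjI)
      show "finite B" using P(1) by (simp add: B_def)
      show "B \<subseteq> L" using v l by (auto simp: B_def)
      show "0 \<notin> B" using v l(2) P(3) linear_0[OF lin] by (force simp: B_def)
      show "L \<subseteq> integer_span B"
      proof
        fix x assume x: "x \<in> L"
        then obtain c where c: "\<forall>b. c b \<in> \<int>" "\<pi> x = (\<Sum>p\<in>P. c p *\<^sub>R p)"
          using P(4) by (auto simp: integer_span_def)
        define s where "s = (\<Sum>p\<in>P. c p *\<^sub>R l p)"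
        have "s = (\<Sum>b\<in>l ` P. c (\<pi> b) *\<^sub>R b)"
          unfolding s_def using inj l(2) by (simp add: sum.reindex)
        then have "s \<in> integer_span (l ` P)" using c(1) unfolding integer_span_def by auto
        then have "s \<in> L"
          using discrete_subgroup_integer_span[OF L, of "l ` P"] P(1) l(1) by blast
        then have "x - s \<in> L" by (rule discrete_subgroup_diff[OF L x])
        moreover have "\<pi> (x - s) = 0"
          using c(2) l(2) by (simp add: s_def linear_diff[OF lin] linear_sum[OF lin] linear_scale[OF lin])
        ultimately obtain k where k: "k \<in> \<int>" "x - s = k *\<^sub>R v" using kernel by blast
        \<comment> \<open>Coefficients are indexed by the vectors of \<open>B\<close>; since \<pi>
          inverts the lift \<open>l\<close> on \<open>P\<close>, the coefficient of a lifted vector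
          is read off from its projection.\<close>
        define c' where "c' w = (if w = v then k else c (\<pi> w))" for w
        have "(\<Sum>p\<in>P. c' (l p) *\<^sub>R l p) = s"
          unfolding s_def using vl l(2) by (intro sum.cong) (auto simp: c'_def)
        then have "x = (\<Sum>b\<in>B. c' b *\<^sub>R b)"
          unfolding sumB using k(2) by (simp add: c'_def algebra_simps)
        moreover have "\<forall>b. c' b \<in> \<int>" using k c by (simp add: c'_def)
        ultimately show "x \<in> integer_span B" by (auto simp: integer_span_def)
      qed
      show "well_conditioned C' B"
        unfolding well_conditioned_def
      proof (intro allI ballI)
        fix c b assume b: "b \<in> B"
        define x where "x = (\<Sum>b\<in>B. c b *\<^sub>R b)"
        have \<pi>x: "\<pi> x = (\<Sum>p\<in>P. c (l p) *\<^sub>R p)"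
          unfolding x_def sumB using l(2) \<pi>v
          by (simp add: linear_add[OF lin] linear_sum[OF lin] linear_scale[OF lin])
        \<comment> \<open>Lifting adds at most \<open>norm v / 2\<close>, which is below
          \<open>3/4 * m\<close> and hence at most \<open>3 * norm p\<close>; this is the origin of
          the factor 4. The coefficients of \<open>x\<close> on the lifts are those of its
          projection on \<open>P\<close>, so the conditioning of \<open>P\<close> applies.\<close>
        have lP: "\<bar>c (l p)\<bar> * norm (l p) \<le> 4 * C * norm x" if p: "p \<in> P" for p
        proof -
          have "m / 4 \<le> norm p" using proj_large[OF l(1)[OF p]] l(2)[OF p] p P(3) by auto
          moreover have "norm (l p) \<le> norm (l p - p) + norm p" by norm
          ultimately have "norm (l p) \<le> 4 * norm p" using l(3)[OF p] m by simp
          then have "\<bar>c (l p)\<bar> * norm (l p) \<le> 4 * (\<bar>c (l p)\<bar> * norm p)"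
            using mult_left_mono[of "norm (l p)" "4 * norm p" "\<bar>c (l p)\<bar>"] by simp
          also have "\<bar>c (l p)\<bar> * norm p \<le> C * norm (\<pi> x)"
            using P(5) p unfolding well_conditioned_def \<pi>x by (elim allE[of _ "\<lambda>p. c (l p)"]) auto
          also have "C * norm (\<pi> x) \<le> C * norm x" using norm_\<pi> C by simp
          finally show ?thesis by simp
        qed
        \<comment> \<open>The \<open>v\<close> term is what remains of \<open>x\<close> after
          removing at most \<open>n\<close> lifted terms, each already bounded.\<close>
        have "\<bar>c v\<bar> * norm v = norm (x - (\<Sum>p\<in>P. c (l p) *\<^sub>R l p))"
          unfolding x_def sumB by simp
        also have "\<dots> \<le> norm x + norm (\<Sum>p\<in>P. c (l p) *\<^sub>R l p)" by (rule norm_triangle_ineq4)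
        also have "norm (\<Sum>p\<in>P. c (l p) *\<^sub>R l p) \<le> (\<Sum>p\<in>P. 4 * C * norm x)"
          using lP by (intro sum_norm_le) auto
        also have "\<dots> \<le> real n * (4 * C * norm x)"
          using cardP C by (simp add: mult_right_mono)
        finally have "\<bar>c v\<bar> * norm v \<le> (1 + real n * (4 * C)) * norm x"
          by (simp add: algebra_simps)
        also have "\<dots> \<le> C' * norm x" using C' by (intro mult_right_mono) auto
        finally have cv: "\<bar>c v\<bar> * norm v \<le> C' * norm x" .
        have "4 * C * norm x \<le> C' * norm x" using C' by (intro mult_right_mono) auto
        then have "\<bar>c (l p)\<bar> * norm (l p) \<le> C' * norm x" if "p \<in> P" for p
          using lP[OF that] by simp
        with cv b have "\<bar>c b\<bar> * norm b \<le> C' * norm x" by (auto simp: B_def)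
        then show "\<bar>c b\<bar> * norm b \<le> C' * norm (\<Sum>b\<in>B. c b *\<^sub>R b)" by (simp only: x_def)
      qed
    qed
  qed
  then show ?case using C' by blast
qed

subsection \<open>Transference\<close>

lemma biorthogonal_independent:
  fixes h w :: "'b \<Rightarrow> 'a::real_inner"
  assumes "finite T"
    and bi: "\<And>b b'. b \<in> T \<Longrightarrow> b' \<in> T \<Longrightarrow> h b \<bullet> w b' = (if b = b' then 1 else 0)"
  shows "inj_on h T" "independent (h ` T)"
proof -
  show inj: "inj_on h T"
    using bi by (intro inj_onI) (metis zero_neq_one)
  show "independent (h ` T)"
  proof (rule independent_if_scalars_zero)
    fix c x assume 0: "(\<Sum>x\<in>h ` T. c x *\<^sub>R x) = 0" and "x \<in> h ` T"
    then obtain b where b: "b \<in> T" "x = h b" by blast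
    have "0 = (\<Sum>b'\<in>T. c (h b') *\<^sub>R h b') \<bullet> w b"
      using 0 inj by (simp add: sum.reindex)
    also have "\<dots> = (\<Sum>b'\<in>T. if b' = b then c (h b') else 0)"
      unfolding inner_sum_left using b bi by (intro sum.cong) auto
    also have "\<dots> = c x" using b assms(1) by simp
    finally show "c x = 0" by simp
  qed (use assms(1) in simp)
qed

text \<open>The dual vector \<open>g b\<close> represents the coordinate functional of
  \<open>b\<close>. Its norm is bounded by testing \<open>well_conditioned\<close> on
  \<open>g b\<close> itself, whose coordinate at \<open>b\<close> is its squared norm.\<close>

lemma dual_basis:
  fixes B :: "'a::euclidean_space set"
  assumes B: "finite B" "0 \<notin> B" "well_conditioned C B" "span B = UNIV"
  obtains g where "\<And>c b. b \<in> B \<Longrightarrow> (\<Sum>b'\<in>B. c b' *\<^sub>R b') \<bullet> g b = c b"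
    "\<And>b. b \<in> B \<Longrightarrow> norm (g b) * norm b \<le> C"
proof -
  have ind: "independent B" using well_conditioned_independent B by blast
  define R where "R b x = representation B x b" for b x
  have sumR: "(\<Sum>b\<in>B. R b x *\<^sub>R b) = x" for x
    unfolding R_def using sum_representation_eq[OF ind _ B(1)] B(4) by simp
  have lin: "linear (R b)" for b
    unfolding R_def using representation_add[OF ind] representation_scale[OF ind] B(4)
    by (intro linearI) simp_all
  \<comment> \<open>Evaluating the adjoint of a linear functional at 1 gives its Riesz
    representative.\<close>
  define g where "g b = adjoint (R b) 1" for b
  have g: "x \<bullet> g b = R b x" for x b
    unfolding g_def using adjoint_works[OF lin] by simp
  have "(\<Sum>b'\<in>B. c b' *\<^sub>R b') \<bullet> g b = c b" if "b \<in> B" for c b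
  proof -
    have R1: "R b b' = (if b' = b then 1 else 0)" if "b' \<in> B" for b'
      unfolding R_def using representation_basis[OF ind that] by auto
    have "(\<Sum>b'\<in>B. c b' *\<^sub>R b') \<bullet> g b = (\<Sum>b'\<in>B. c b' * R b b')"
      by (simp add: inner_sum_left flip: g)
    also have "\<dots> = (\<Sum>b'\<in>B. if b' = b then c b' else 0)"
      by (intro sum.cong) (auto simp: R1)
    finally show ?thesis using that B(1) by simp
  qed
  moreover have "norm (g b) * norm b \<le> C" if b: "b \<in> B" for b
  proof (cases "g b = 0")
    case True
    have "b \<bullet> g b = R b b" by (rule g)
    also have "\<dots> = 1" unfolding R_def using representation_basis[OF ind b] by simp
    finally show ?thesis using True by simp
  next
    case False
    have "\<bar>R b (g b)\<bar> * norm b \<le> C * norm (\<Sum>b'\<in>B. R b' (g b) *\<^sub>R b')"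
      using B(3) b unfolding well_conditioned_def by (elim allE[of _ "\<lambda>b'. R b' (g b)"]) auto
    then have "(g b \<bullet> g b) * norm b \<le> C * norm (g b)"
      unfolding sumR using g[of "g b" b] by (metis abs_of_nonneg inner_ge_zero)
    then have "norm (g b) * (norm (g b) * norm b) \<le> norm (g b) * C"
      by (simp add: power2_norm_eq_inner[symmetric] power2_eq_square mult_ac)
    then show ?thesis using False by simp
  qed
  ultimately show thesis by (rule that)
qed

text \<open>An injective linear map is bounded below, and a nonzero integer vector has norm at least
  1.\<close>

lemma lattice_basis_discrete_subgroup:
  fixes A :: "real^'n^'n"
  assumes A: "lattice_basis A M"
  shows "discrete_subgroup M"
proof -
  have M: "M = {A *v z | z. \<forall>i. z $ i \<in> \<int>}" and inv: "invertible A"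
    using A by (auto simp: lattice_basis_def)
  have lin: "linear ((*v) A)" by simp
  have inj: "inj ((*v) A)"
    using inv by (simp add: invertible_left_inverse matrix_left_invertible_injective)
  obtain e where e: "e > 0" "\<And>x. e * norm x \<le> norm (A *v x)"
    using linear_inj_bounded_below_pos[OF lin inj] by blast
  show ?thesis
    unfolding discrete_subgroup_def
  proof (intro conjI ballI)
    show "0 \<in> M" unfolding M by (auto intro!: exI[of _ 0])
    show "x - y \<in> M" if xy: "x \<in> M" "y \<in> M" for x y
    proof -
      obtain z w where "x = A *v z" "y = A *v w" "\<forall>i. z $ i \<in> \<int>" "\<forall>i. w $ i \<in> \<int>"
        using xy unfolding M by blast
      then have "x - y = A *v (z - w)" "\<forall>i. (z - w) $ i \<in> \<int>"
        by (auto simp: matrix_vector_mult_diff_distrib)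
      then show ?thesis unfolding M by blast
    qed
    have "e \<le> norm x" if x: "x \<in> M" "x \<noteq> 0" for x
    proof -
      obtain z where z: "x = A *v z" "\<forall>i. z $ i \<in> \<int>" using x unfolding M by blast
      then have "z \<noteq> 0" using x by auto
      then obtain i where "z $ i \<noteq> 0" by (auto simp: vec_eq_iff)
      then have "1 \<le> \<bar>z $ i\<bar>" using z(2) Ints_nonzero_abs_ge1 by blast
      also have "\<dots> \<le> norm z" by (rule component_le_norm_cart)
      finally have "e * 1 \<le> e * norm z" using e by simp
      then show ?thesis using e(2)[of z] z by simp
    qed
    then show "\<exists>e>0. \<forall>x\<in>M. x \<noteq> 0 \<longrightarrow> e \<le> norm x" using e(1) by blast
  qed
qed

lemma lattice_basis_span:
  fixes A :: "real^'n^'n"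
  assumes A: "lattice_basis A M"
  shows "span M = UNIV"
proof -
  have M: "M = {A *v z | z. \<forall>i. z $ i \<in> \<int>}" and inv: "invertible A"
    using A by (auto simp: lattice_basis_def)
  have lin: "linear ((*v) A)" by simp
  have "surj ((*v) A)"
    using inv by (simp add: invertible_right_inverse matrix_right_invertible_surjective)
  then have "UNIV = span ((*v) A ` Basis)"
    using linear_span_image[OF lin, of Basis] by simp
  also have "(*v) A ` Basis \<subseteq> M"
    unfolding M by (auto simp: Basis_vec_def axis_def)
  finally show ?thesis using span_mono by blast
qed

section \<open>Diagonal scalings and their action on lattices\<close>

lemma diag_exp_mult_nth: "(diag_exp \<tau> *v x) $ i = exp (\<tau> $ i) * x $ i"
proof -
  have "(\<Sum>j\<in>UNIV. (if i = j then exp (\<tau> $ i) else 0) * x $ j)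
      = (\<Sum>j\<in>UNIV. if i = j then exp (\<tau> $ i) * x $ j else 0)"
    by (intro sum.cong) auto
  then show ?thesis by (simp add: diag_exp_def matrix_vector_mult_def)
qed

lemma diag_exp_uminus_cancel: "diag_exp \<tau> *v (diag_exp (- \<tau>) *v x) = x"
  by (simp add: vec_eq_iff diag_exp_mult_nth exp_minus)

lemma inner_diag_exp: "x \<bullet> (diag_exp \<tau> *v y) = (diag_exp \<tau> *v x) \<bullet> y"
  by (simp add: inner_vec_def diag_exp_mult_nth mult_ac)

lemma inj_diag_exp: "inj ((*v) (diag_exp \<tau>))"
  using diag_exp_uminus_cancel[of "- \<tau>"] by (metis injI minus_minus)

lemma lattice_basis_diag_exp:
  assumes "lattice_basis A M"
  shows "lattice_basis (diag_exp \<tau> ** A) ((*v) (diag_exp \<tau>) ` M)"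
proof -
  have "invertible (diag_exp \<tau>)"
    using inj_diag_exp by (simp add: invertible_left_inverse matrix_left_invertible_injective)
  then have "invertible (diag_exp \<tau> ** A)"
    using assms by (simp add: lattice_basis_def invertible_mult)
  moreover have "(*v) (diag_exp \<tau>) ` {A *v z | z. \<forall>i. z $ i \<in> \<int>}
      = {(diag_exp \<tau> ** A) *v z | z. \<forall>i. z $ i \<in> \<int>}"
    by (auto simp: matrix_vector_mul_assoc[symmetric])
  ultimately show ?thesis using assms by (simp add: lattice_basis_def)
qed

text \<open>This is the set whose infimum is the successive minimum, with membership in the scaled
  box written coordinatewise. Working with radii postpones infima, and any question of attainment,
  to the final estimate.\<close>

definition admissible_radii :: "nat \<Rightarrow> real^'n \<Rightarrow> (real^'n) set \<Rightarrow> real set" where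
  "admissible_radii k \<tau> M = {r. r > 0 \<and> (\<exists>S. S \<subseteq> M \<and>
     (\<forall>x\<in>S. \<forall>i. \<bar>x $ i\<bar> \<le> r * exp (\<tau> $ i)) \<and> independent S \<and> card S = k)}"

lemma infnorm_le_iff_cart: "infnorm (x::real^'n) \<le> r \<longleftrightarrow> (\<forall>i. \<bar>x $ i\<bar> \<le> r)"
proof
  show "\<forall>i. \<bar>x $ i\<bar> \<le> r" if "infnorm x \<le> r"
    using that component_le_infnorm_cart order_trans by blast
  show "infnorm x \<le> r" if "\<forall>i. \<bar>x $ i\<bar> \<le> r"
    unfolding infnorm_cart using that by (intro cSup_least) auto
qed

lemma scaled_box_iff:
  fixes x \<tau> :: "real^'n"
  assumes "r > 0"
  shows "x \<in> (\<lambda>x. r *\<^sub>R x) ` box_at \<tau> \<longleftrightarrow> (\<forall>i. \<bar>x $ i\<bar> \<le> r * exp (\<tau> $ i))"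
proof
  assume "x \<in> (\<lambda>x. r *\<^sub>R x) ` box_at \<tau>"
  then obtain z where z: "x = r *\<^sub>R (diag_exp \<tau> *v z)" "\<forall>i. \<bar>z $ i\<bar> \<le> 1"
    by (auto simp: box_at_def infnorm_le_iff_cart)
  show "\<forall>i. \<bar>x $ i\<bar> \<le> r * exp (\<tau> $ i)"
  proof
    fix i
    have "r * exp (\<tau> $ i) * \<bar>z $ i\<bar> \<le> r * exp (\<tau> $ i) * 1"
      using z(2) assms by (intro mult_left_mono) auto
    then show "\<bar>x $ i\<bar> \<le> r * exp (\<tau> $ i)"
      using assms by (simp add: z(1) diag_exp_mult_nth abs_mult mult_ac)
  qed
next
  assume x: "\<forall>i. \<bar>x $ i\<bar> \<le> r * exp (\<tau> $ i)"
  define z where "z = (1 / r) *\<^sub>R (diag_exp (- \<tau>) *v x)"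
  have "x = r *\<^sub>R (diag_exp \<tau> *v z)"
    using assms by (simp add: z_def vec_eq_iff diag_exp_mult_nth exp_minus field_simps)
  moreover have "infnorm z \<le> 1"
    unfolding infnorm_le_iff_cart
  proof
    fix i
    have "\<bar>z $ i\<bar> = \<bar>x $ i\<bar> / (r * exp (\<tau> $ i))"
      using assms by (simp add: z_def diag_exp_mult_nth exp_minus abs_mult field_simps)
    then show "\<bar>z $ i\<bar> \<le> 1" using x assms by (simp add: divide_le_eq_1)
  qed
  ultimately show "x \<in> (\<lambda>x. r *\<^sub>R x) ` box_at \<tau>" by (auto simp: box_at_def)
qed

lemma successive_minimum_eq: 
  fixes M :: "(real^'n) set"
  shows "successive_minimum k (box_at \<tau>) M = Inf (admissible_radii k \<tau> M)"
proof -
  have "S \<subseteq> (\<lambda>x. r *\<^sub>R x) ` box_at \<tau> \<inter> M \<longleftrightarrow>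
      S \<subseteq> M \<and> (\<forall>x\<in>S. \<forall>i. \<bar>x $ i\<bar> \<le> r * exp (\<tau> $ i))" if "r > 0" for r and S :: "(real^'n) set"
    using scaled_box_iff[OF that, of _ \<tau>] by blast
  then have "{r. r > 0 \<and> (\<exists>S. S \<subseteq> (\<lambda>x. r *\<^sub>R x) ` box_at \<tau> \<inter> M \<and> independent S \<and> card S = k)}
      = admissible_radii k \<tau> M"
    unfolding admissible_radii_def by (intro Collect_cong) (metis (no_types, lifting))
  then show ?thesis by (simp add: successive_minimum_def)
qed

text \<open>Lower half of transference: some pair of chosen vectors has a nonzero integer as inner
  product, and the opposite scalings cancel in each of its coordinate products.\<close>

lemma admissible_radii_product:
  fixes \<tau> :: "real^'n"
  assumes r: "r \<in> admissible_radii k \<tau> M" and s: "s \<in> admissible_radii l (- \<tau>) (dual_lattice M)"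
    and kl: "k + l = CARD('n) + 1"
  shows "1 \<le> real CARD('n) * r * s"
proof -
  obtain S where S: "S \<subseteq> M" "\<And>x i. x \<in> S \<Longrightarrow> \<bar>x $ i\<bar> \<le> r * exp (\<tau> $ i)" "independent S" "card S = k"
    using r unfolding admissible_radii_def by blast
  obtain T where T: "T \<subseteq> dual_lattice M" "\<And>y i. y \<in> T \<Longrightarrow> \<bar>y $ i\<bar> \<le> s * exp ((- \<tau>) $ i)"
      "independent T" "card T = l"
    using s unfolding admissible_radii_def by blast
  have "\<exists>x\<in>S. \<exists>y\<in>T. x \<bullet> y \<noteq> 0"
  \<comment> \<open>If all pairs were orthogonal, the dimensions would add up to one more than the
    ambient dimension.\<close>
  proof (rule ccontr)
    assume "\<not> ?thesis"
    then have "dim (S \<union> T) = dim S + dim T" by (intro dim_orthogonal_sum) blast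
    moreover have "dim S = k" "dim T = l" using S T dim_eq_card_independent by blast+
    moreover have "dim (S \<union> T) \<le> CARD('n)" using dim_subset_UNIV[of "S \<union> T"] by simp
    ultimately show False using kl by simp
  qed
  then obtain x y where xy: "x \<in> S" "y \<in> T" "x \<bullet> y \<noteq> 0" by blast
  then have "x \<bullet> y \<in> \<int>" using S(1) T(1) by (auto simp: dual_lattice_def)
  then have "1 \<le> \<bar>x \<bullet> y\<bar>" using xy(3) Ints_nonzero_abs_ge1 by blast
  also have "\<dots> \<le> (\<Sum>i\<in>UNIV. \<bar>x $ i * y $ i\<bar>)" by (simp add: inner_vec_def sum_abs)
  also have "\<dots> \<le> (\<Sum>i\<in>(UNIV::'n set). r * s)"
  proof (rule sum_mono)
    fix i
    have "\<bar>x $ i * y $ i\<bar> \<le> (r * exp (\<tau> $ i)) * (s * exp ((- \<tau>) $ i))"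
      unfolding abs_mult using S(2)[OF xy(1), of i] T(2)[OF xy(2), of i] by (intro mult_mono) auto
    also have "\<dots> = r * s" by (simp add: exp_minus)
    finally show "\<bar>x $ i * y $ i\<bar> \<le> r * s" .
  qed
  finally show ?thesis by (simp add: mult.assoc)
qed

text \<open>Upper half of transference: a radius failing for the lattice yields a radius that works
  for the dual. The first conjunct ensures that the primal infimum is over a nonempty set.\<close>

lemma transference:
  "\<exists>C>0. \<forall>\<Lambda> (\<tau>::real^'n). full_rank_lattice \<Lambda> \<longrightarrow>
     (\<forall>k\<le>CARD('n). admissible_radii k \<tau> \<Lambda> \<noteq> {}) \<and>
     (\<forall>k l r. k + l = CARD('n) + 1 \<longrightarrow> r > 0 \<longrightarrow> r \<notin> admissible_radii k \<tau> \<Lambda> \<longrightarrow>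
        C / r \<in> admissible_radii l (- \<tau>) (dual_lattice \<Lambda>))"
proof -
  obtain C where C: "C > 0" and red: "\<And>L::(real^'n) set. discrete_subgroup L \<Longrightarrow>
     dim L \<le> CARD('n) \<Longrightarrow>
     \<exists>B. finite B \<and> B \<subseteq> L \<and> 0 \<notin> B \<and> L \<subseteq> integer_span B \<and> well_conditioned C B"
    using reduced_basis[of "CARD('n)"] by blast
  show ?thesis
  proof (intro exI[of _ C] conjI C allI impI)
    fix \<Lambda> :: "(real^'n) set" and \<tau> :: "real^'n"
    assume "full_rank_lattice \<Lambda>"
    then obtain A where A: "lattice_basis A \<Lambda>" by (auto simp: full_rank_lattice_def)
    \<comment> \<open>After this rescaling the box becomes the unit cube, so norm bounds on a
      reduced basis of \<open>M\<close> turn into box bounds for \<Lambda>.\<close>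
    define M where "M = (*v) (diag_exp (- \<tau>)) ` \<Lambda>"
    have M: "lattice_basis (diag_exp (- \<tau>) ** A) M"
      unfolding M_def using lattice_basis_diag_exp[OF A] .
    have "dim M \<le> CARD('n)" using dim_subset_UNIV[of M] by simp
    then obtain B where B: "finite B" "B \<subseteq> M" "0 \<notin> B" "M \<subseteq> integer_span B" "well_conditioned C B"
      using red[OF lattice_basis_discrete_subgroup[OF M]] by blast
    have ind: "independent B" using well_conditioned_independent B by blast
    have "integer_span B \<subseteq> span B"
      unfolding integer_span_def by (auto intro: span_sum span_scale span_base)
    then have "span M \<subseteq> span B" using B(4) span_minimal[OF _ subspace_span] by blast
    then have spanB: "span B = UNIV" using lattice_basis_span[OF M] by blast
    then have cardB: "card B = CARD('n)"
      using dim_span_eq_card_independent[OF ind] by simp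
    \<comment> \<open>Scaling back by \<open>diag_exp \<tau>\<close> preserves independence and
      cardinality, and coordinates are bounded by the Euclidean norm.\<close>
    have adm: "r \<in> admissible_radii (card S) \<tau> \<Lambda>"
      if rS: "r > 0" "S \<subseteq> B" "\<And>b. b \<in> S \<Longrightarrow> norm b \<le> r" for r S
    proof -
      let ?S = "(*v) (diag_exp \<tau>) ` S"
      have "?S \<subseteq> \<Lambda>"
      proof
        fix x assume "x \<in> ?S"
        then obtain b where b: "b \<in> S" "x = diag_exp \<tau> *v b" by blast
        then have "b \<in> M" using rS B(2) by blast
        then obtain y where "y \<in> \<Lambda>" "b = diag_exp (- \<tau>) *v y" by (auto simp: M_def)
        then show "x \<in> \<Lambda>" using b(2) by (simp only: diag_exp_uminus_cancel)
      qed
      moreover have "\<bar>x $ i\<bar> \<le> r * exp (\<tau> $ i)" if x: "x \<in> ?S" for x i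
      proof -
        obtain b where b: "b \<in> S" "x = diag_exp \<tau> *v b" using x by blast
        have "\<bar>b $ i\<bar> \<le> r" using component_le_norm_cart[of b i] rS(3)[OF b(1)] by linarith
        then show ?thesis by (simp add: b(2) diag_exp_mult_nth abs_mult)
      qed
      moreover have "independent ?S"
      proof (rule linear_independent_injective_image)
        show "independent S" using independent_mono[OF ind rS(2)] .
        show "inj_on ((*v) (diag_exp \<tau>)) (span S)" using inj_diag_exp inj_on_subset by blast
      qed simp
      moreover have "card ?S = card S"
        using inj_diag_exp by (intro card_image) (blast intro: inj_on_subset)
      ultimately show ?thesis unfolding admissible_radii_def using rS(1) by blast
    qed
    show "admissible_radii k \<tau> \<Lambda> \<noteq> {}" if k: "k \<le> CARD('n)" for k
    proof -
      obtain S where S: "S \<subseteq> B" "card S = k"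
        using obtain_subset_with_card_n[of k B] k cardB by metis
      have "norm b \<le> 1 + (\<Sum>b\<in>B. norm b)" if "b \<in> S" for b
        using member_le_sum[of b B norm] that S(1) B(1) by auto
      moreover have "0 < 1 + (\<Sum>b\<in>B. norm b)" by (simp add: add_pos_nonneg sum_nonneg)
      ultimately show ?thesis using adm S by blast
    qed
    fix k l r
    assume kl: "k + l = CARD('n) + 1" and r: "0 < (r::real)" and nr: "r \<notin> admissible_radii k \<tau> \<Lambda>"
    obtain g where g: "\<And>c b. b \<in> B \<Longrightarrow> (\<Sum>b'\<in>B. c b' *\<^sub>R b') \<bullet> g b = c b"
      and ng: "\<And>b. b \<in> B \<Longrightarrow> norm (g b) * norm b \<le> C"
      using dual_basis[OF B(1,3,5) spanB] by blast
    \<comment> \<open>\<open>S\<close> collects the short basis vectors. It has fewer than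
      \<open>k\<close> elements, for otherwise \<open>r\<close> would be admissible, so at least
      \<open>l\<close> of the basis vectors lie outside \<open>S\<close>.\<close>
    define S where "S = {b \<in> B. norm b \<le> r}"
    have SB: "S \<subseteq> B" by (auto simp: S_def)
    have "card S < k"
    proof (rule ccontr)
      assume "\<not> ?thesis"
      then obtain S' where "S' \<subseteq> S" "card S' = k"
        using obtain_subset_with_card_n[of k S] by (metis not_less)
      then show False using adm[OF r, of S'] nr by (auto simp: S_def)
    qed
    then have "l \<le> card (B - S)" using card_Diff_subset[of S B] SB B(1) cardB kl
      by (simp add: finite_subset)
    then obtain T where T: "T \<subseteq> B - S" "card T = l" "finite T"
      using obtain_subset_with_card_n by metis
    \<comment> \<open>Diagonal matrices are self-adjoint, so \<open>h b\<close> is dual to the basis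
      \<open>diag_exp \<tau> *v b\<close> of \<Lambda>.\<close>
    define h where "h b = diag_exp (- \<tau>) *v g b" for b
    have gb: "b' \<bullet> g b = (if b = b' then 1 else 0)" if bb: "b \<in> B" "b' \<in> B" for b b'
    proof -
      have "(\<Sum>x\<in>B. (if x = b' then 1 else 0) *\<^sub>R x) = (\<Sum>x\<in>B. if x = b' then x else 0)"
        by (intro sum.cong) auto
      also have "\<dots> = b'" using bb B(1) by simp
      finally show ?thesis using g[OF bb(1), of "\<lambda>x. if x = b' then 1 else 0"] by simp
    qed
    have "h b \<bullet> (diag_exp \<tau> *v b') = (if b = b' then 1 else 0)" if "b \<in> T" "b' \<in> T" for b b'
    proof -
      have "h b \<bullet> (diag_exp \<tau> *v b') = g b \<bullet> b'"
        unfolding inner_diag_exp h_def diag_exp_uminus_cancel ..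
      moreover have "b \<in> B" "b' \<in> B" using that T(1) by blast+
      ultimately show ?thesis using gb[of b b'] by (simp add: inner_commute)
    qed
    from biorthogonal_independent[OF T(3), of h, OF this]
    have h: "inj_on h T" "independent (h ` T)" by blast+
    have "h ` T \<subseteq> dual_lattice \<Lambda>"
    proof
      fix y assume "y \<in> h ` T"
      then obtain b where b: "b \<in> T" "y = h b" by blast
      \<comment> \<open>This inner product is the coordinate at \<open>b\<close> of the rescaled
        \<open>x\<close>, which is an integer because \<open>M\<close> lies in the integer span of
        \<open>B\<close>.\<close>
      have "x \<bullet> y \<in> \<int>" if x: "x \<in> \<Lambda>" for x
      proof -
        have "diag_exp (- \<tau>) *v x \<in> integer_span B" using x B(4) by (auto simp: M_def)
        then obtain c where c: "\<forall>b. c b \<in> \<int>" "diag_exp (- \<tau>) *v x = (\<Sum>b\<in>B. c b *\<^sub>R b)"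
          by (auto simp: integer_span_def)
        have "x \<bullet> y = (diag_exp (- \<tau>) *v x) \<bullet> g b"
          by (simp add: b(2) h_def inner_diag_exp)
        also have "\<dots> = c b" unfolding c(2) using g b T(1) by blast
        finally show ?thesis using c(1) by simp
      qed
      then show "y \<in> dual_lattice \<Lambda>" by (simp add: dual_lattice_def)
    qed
    moreover have "\<bar>y $ i\<bar> \<le> C / r * exp ((- \<tau>) $ i)" if y: "y \<in> h ` T" for y i
    proof -
      obtain b where b: "b \<in> T" "y = h b" using y by blast
      \<comment> \<open>Being outside \<open>S\<close> means that \<open>b\<close> is long, so its
        dual vector is short.\<close>
      have bB: "b \<in> B" "r \<le> norm b" using b T(1) by (auto simp: S_def)
      have "norm (g b) * r \<le> norm (g b) * norm b" using bB by (intro mult_left_mono) auto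
      also have "\<dots> \<le> C" using ng bB by blast
      finally have "norm (g b) \<le> C / r" using r by (simp add: field_simps)
      then have "\<bar>g b $ i\<bar> \<le> C / r" using component_le_norm_cart[of "g b" i] by linarith
      then have "exp ((- \<tau>) $ i) * \<bar>g b $ i\<bar> \<le> exp ((- \<tau>) $ i) * (C / r)"
        by (intro mult_left_mono) auto
      then show ?thesis
        unfolding b(2) h_def diag_exp_mult_nth abs_mult by (simp add: mult.commute)
    qed
    moreover have "card (h ` T) = l" using h(1) T(2) by (simp add: card_image)
    moreover have "0 < C / r" using C r by simp
    ultimately show "C / r \<in> admissible_radii l (- \<tau>) (dual_lattice \<Lambda>)"
      unfolding admissible_radii_def using h(2) by blast
  qed
qed

text \<open>As \<open>k\<close> is positive, an admissible radius comes with a nonzero lattice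
  vector, whose rescaling has norm at least some \<open>e\<close>. The choice of \<open>r\<close>
  forces its l1 norm down to \<open>e / 2\<close>. Such a radius is what \<open>transference\<close>
  needs to produce one for the dual.\<close>

lemma admissible_radii_small:
  assumes M: "full_rank_lattice M" and "k \<ge> 1"
  obtains r where "r > 0" "r \<notin> admissible_radii k \<tau> M"
proof -
  obtain A where "lattice_basis A M" using M by (auto simp: full_rank_lattice_def)
  then have "discrete_subgroup ((*v) (diag_exp (- \<tau>)) ` M)"
    using lattice_basis_discrete_subgroup lattice_basis_diag_exp by blast
  then obtain e where e: "e > 0" "\<And>x. x \<in> M \<Longrightarrow> diag_exp (- \<tau>) *v x \<noteq> 0 \<Longrightarrow> e \<le> norm (diag_exp (- \<tau>) *v x)"
    unfolding discrete_subgroup_def by blast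
  define r where "r = e / (2 * real CARD('a))"
  have "r > 0" using e by (simp add: r_def)
  moreover have "r \<notin> admissible_radii k \<tau> M"
  proof
    assume "r \<in> admissible_radii k \<tau> M"
    then obtain S where S: "S \<subseteq> M" "\<And>x i. x \<in> S \<Longrightarrow> \<bar>x $ i\<bar> \<le> r * exp (\<tau> $ i)"
        "independent S" "card S = k"
      unfolding admissible_radii_def by blast
    then have "S \<noteq> {}" using \<open>k \<ge> 1\<close> by auto
    then obtain x where x: "x \<in> S" by blast
    then have "x \<noteq> 0" using S(3) dependent_zero by blast
    then have "diag_exp (- \<tau>) *v x \<noteq> 0"
      using diag_exp_uminus_cancel[of \<tau> x] by auto
    then have "e \<le> norm (diag_exp (- \<tau>) *v x)" using e(2) S(1) x by blast
    also have "\<dots> \<le> (\<Sum>i\<in>UNIV. \<bar>(diag_exp (- \<tau>) *v x) $ i\<bar>)" by (rule norm_le_l1_cart)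
    also have "\<dots> \<le> (\<Sum>i\<in>(UNIV::'a set). r)"
    proof (rule sum_mono)
      fix i
      have "exp (- \<tau> $ i) * \<bar>x $ i\<bar> \<le> exp (- \<tau> $ i) * (r * exp (\<tau> $ i))"
        using S(2)[OF x, of i] by (intro mult_left_mono) auto
      then show "\<bar>(diag_exp (- \<tau>) *v x) $ i\<bar> \<le> r"
        by (simp add: diag_exp_mult_nth abs_mult exp_minus field_simps)
    qed
    also have "\<dots> = e / 2" by (simp add: r_def)
    finally show False using e(1) by simp
  qed
  ultimately show ?thesis by (rule that)
qed

text \<open>The product of the two minima lies between \<open>1 / d\<close> and \<open>C\<close>,
  uniformly in \<tau>; taking logarithms gives the bound.\<close>

lemma log_min_transference:
  fixes \<Lambda> :: "(real^'n) set"
  assumes \<Lambda>: "full_rank_lattice \<Lambda>" and kl: "k + l = CARD('n) + 1" "1 \<le> k" "1 \<le> l"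
  obtains K where "\<And>\<tau>. \<bar>log_min k \<Lambda> \<tau> + log_min l (dual_lattice \<Lambda>) (- \<tau>)\<bar> \<le> K"
proof -
  obtain C where C: "C > 0"
    and ne: "\<And>\<tau>::real^'n. admissible_radii k \<tau> \<Lambda> \<noteq> {}"
    and tr: "\<And>(\<tau>::real^'n) r. r > 0 \<Longrightarrow> r \<notin> admissible_radii k \<tau> \<Lambda> \<Longrightarrow>
        C / r \<in> admissible_radii l (- \<tau>) (dual_lattice \<Lambda>)"
  proof -
    have "k \<le> CARD('n)" using kl by simp
    then show ?thesis using transference[where 'n = 'n] \<Lambda> kl(1) that by metis
  qed
  define d where "d = real CARD('n)"
  have d: "d > 0" by (simp add: d_def)
  have "\<bar>log_min k \<Lambda> \<tau> + log_min l (dual_lattice \<Lambda>) (- \<tau>)\<bar> \<le> \<bar>ln C\<bar> + \<bar>ln d\<bar>" for \<tau>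
  proof -
    define X where "X = admissible_radii k \<tau> \<Lambda>"
    define Y where "Y = admissible_radii l (- \<tau>) (dual_lattice \<Lambda>)"
    have Xne: "X \<noteq> {}" using ne by (simp add: X_def)
    have Yne: "Y \<noteq> {}" using admissible_radii_small[OF \<Lambda> kl(2)] tr unfolding Y_def by blast
    have Xpos: "r > 0" if "r \<in> X" for r using that by (auto simp: X_def admissible_radii_def)
    have Ypos: "r > 0" if "r \<in> Y" for r using that by (auto simp: Y_def admissible_radii_def)
    have XY: "1 \<le> d * r * s" if "r \<in> X" "s \<in> Y" for r s
      using that admissible_radii_product[OF _ _ kl(1)] unfolding X_def Y_def d_def by blast
    have bX: "bdd_below X" and bY: "bdd_below Y"
      using Xpos Ypos by (auto intro!: bdd_belowI[of _ 0] less_imp_le)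
    \<comment> \<open>The product bound passes to infima one variable at a time; both infima turn
      out positive, as the logarithms require.\<close>
    have low1: "1 / (d * s) \<le> Inf X" if "s \<in> Y" for s
      using XY[OF _ that] Ypos[OF that] d Xne by (intro cInf_greatest) (auto simp: field_simps)
    obtain s0 where "s0 \<in> Y" using Yne by blast
    then have "0 < 1 / (d * s0)" using Ypos d by simp
    then have Xp: "0 < Inf X" using low1[OF \<open>s0 \<in> Y\<close>] by linarith
    have low: "1 / (d * Inf X) \<le> Inf Y"
      using low1 Ypos d Yne Xp by (intro cInf_greatest) (auto simp: field_simps)
    then have Yp: "0 < Inf Y" using Xp d by (smt (verit) divide_pos_pos mult_pos_pos)
    have lower: "1 / d \<le> Inf X * Inf Y"
      using low Xp d by (simp add: field_simps)
    have upper: "Inf X * Inf Y \<le> C"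
    proof (rule ccontr)
      assume "\<not> ?thesis"
      then have "C / Inf Y < Inf X" using Yp by (simp add: field_simps)
      \<comment> \<open>Lying below \<open>Inf X\<close>, this \<open>r\<close> is not admissible,
        so \<open>C / r\<close> belongs to \<open>Y\<close> although it is smaller than
        \<open>Inf Y\<close>.\<close>
      then obtain r where r: "C / Inf Y < r" "r < Inf X" using dense by blast
      have "0 < C / Inf Y" using C Yp by simp
      then have r0: "r > 0" using r by linarith
      have "r \<notin> X" using r(2) cInf_lower[OF _ bX] by force
      then have "C / r \<in> Y" using tr r0 by (simp add: X_def Y_def)
      then have "Inf Y \<le> C / r" by (rule cInf_lower[OF _ bY])
      then show False using r(1) r0 Yp by (simp add: field_simps)
    qed
    have "ln (Inf X * Inf Y) \<le> ln C" using upper Xp Yp C by simp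
    moreover have "ln (1 / d) \<le> ln (Inf X * Inf Y)" using lower Xp Yp d by (subst ln_le_cancel_iff) auto
    moreover have "ln (1 / d) = - ln d" using d by (simp add: ln_div)
    ultimately have "\<bar>ln (Inf X * Inf Y)\<bar> \<le> \<bar>ln C\<bar> + \<bar>ln d\<bar>" by linarith
    then show ?thesis
      using Xp Yp by (simp add: log_min_def successive_minimum_eq ln_mult flip: X_def Y_def)
  qed
  then show thesis by (rule that)
qed

subsection \<open>Comparison of upper limits\<close>

text \<open>Strict bounds by a real number hold eventually, so infinite upper limits need no
  separate treatment. The bound \<rho> \<le> \<open>m\<close> serves a positive threshold, the bound
  \<open>1 / m\<close> \<le> \<rho> a negative one.\<close>

lemma Limsup_scaled_bounds:
  fixes u v \<rho> e :: "'a \<Rightarrow> real"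
  assumes "1 \<le> m" "(e \<longlongrightarrow> 0) F"
    and ev: "eventually (\<lambda>x. 1 / m \<le> \<rho> x \<and> \<rho> x \<le> m \<and> u x = \<rho> x * v x + e x) F"
    and c: "0 < c"
  shows "Limsup F (\<lambda>x. ereal (v x)) < ereal c \<Longrightarrow> Limsup F (\<lambda>x. ereal (u x)) \<le> ereal (m * c)"
    and "Limsup F (\<lambda>x. ereal (v x)) < ereal (- c) \<Longrightarrow> Limsup F (\<lambda>x. ereal (u x)) \<le> ereal (- (c / m))"
proof -
  \<comment> \<open>The vanishing error \<open>e\<close> is absorbed by an arbitrary positive
    \<epsilon>.\<close>
  have upper: "Limsup F (\<lambda>x. ereal (u x)) \<le> ereal s"
    if *: "eventually (\<lambda>x. \<rho> x * v x \<le> s) F" for s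
  proof (rule ereal_le_epsilon2)
    fix \<epsilon> :: real assume "0 < \<epsilon>"
    then have "eventually (\<lambda>x. \<bar>e x\<bar> < \<epsilon>) F"
      using assms(2) by (auto simp: tendsto_iff dist_real_def)
    then have "eventually (\<lambda>x. ereal (u x) \<le> ereal s + ereal \<epsilon>) F"
      using ev * by eventually_elim auto
    then show "Limsup F (\<lambda>x. ereal (u x)) \<le> ereal s + ereal \<epsilon>"
      by (rule Limsup_bounded)
  qed
  show "Limsup F (\<lambda>x. ereal (u x)) \<le> ereal (m * c)" if "Limsup F (\<lambda>x. ereal (v x)) < ereal c"
  proof (rule upper)
    show "eventually (\<lambda>x. \<rho> x * v x \<le> m * c) F"
      using ev Limsup_lessD[OF that]
    proof eventually_elim
      case (elim x)
      have "0 \<le> 1 / m" using \<open>1 \<le> m\<close> by simp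
      then have "0 \<le> \<rho> x" using elim by linarith
      then have "\<rho> x * v x \<le> \<rho> x * c" using elim by (intro mult_left_mono) auto
      also have "\<dots> \<le> m * c" using elim c by simp
      finally show ?case .
    qed
  qed
  show "Limsup F (\<lambda>x. ereal (u x)) \<le> ereal (- (c / m))" if "Limsup F (\<lambda>x. ereal (v x)) < ereal (- c)"
  proof (rule upper)
    show "eventually (\<lambda>x. \<rho> x * v x \<le> - (c / m)) F"
      using ev Limsup_lessD[OF that]
    proof eventually_elim
      case (elim x)
      have "0 \<le> 1 / m" using \<open>1 \<le> m\<close> by simp
      then have "0 \<le> \<rho> x" using elim by linarith
      then have "\<rho> x * v x \<le> \<rho> x * (- c)" using elim by (intro mult_left_mono) auto
      moreover have "1 / m * c \<le> \<rho> x * c" using elim c by (intro mult_right_mono) auto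
      ultimately show ?case by simp
    qed
  qed
qed

text \<open>For nonnegative \<open>U\<close> the premise from \<open>V\<close> to \<open>U\<close>
  bounds it from above. For negative \<open>U\<close> the other premise pushes \<open>V\<close> at
  least as far below zero, up to the factor \<open>m\<close>.\<close>

lemma ereal_abs_le_scaled:
  fixes U V :: ereal
  assumes m: "1 \<le> m"
    and up: "\<And>c. 0 < c \<Longrightarrow> V < ereal c \<Longrightarrow> U \<le> ereal (m * c)"
    and dn: "\<And>c. 0 < c \<Longrightarrow> U < ereal (- c) \<Longrightarrow> V \<le> ereal (- (c / m))"
  shows "\<bar>U\<bar> \<le> ereal m * \<bar>V\<bar>"
proof (cases "0 \<le> U")
  case True
  show ?thesis
  proof (cases "\<bar>V\<bar>")
    case PInf
    then show ?thesis using m by simp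
  next
    case (real r)
    then have r: "r \<ge> 0" "V \<le> ereal r" by (cases V; auto)+
    have "U \<le> ereal (m * r)"
    proof (rule ereal_le_epsilon2)
      fix e :: real assume "0 < e"
      then have "V < ereal (r + e / m)" "0 < r + e / m"
        using r m by (auto intro: le_less_trans add_nonneg_pos)
      from up[OF this(2,1)] show "U \<le> ereal (m * r) + ereal e"
        using m by (simp add: algebra_simps)
    qed
    then show ?thesis using True real by simp
  next
    case MInf
    then show ?thesis by (cases V) auto
  qed
next
  case False
  \<comment> \<open>It suffices to dominate every real \<open>c\<close> below
    \<open>\<bar>U\<bar>\<close>, which also covers infinite \<open>U\<close>.\<close>
  have neg: "ereal c \<le> ereal m * \<bar>V\<bar>" if "0 < c" "U < ereal (- c)" for c
  proof -
    have "V \<le> ereal (- (c / m))" using dn that by blast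
    then have "ereal (c / m) \<le> \<bar>V\<bar>" using m that by (cases V) auto
    then have "ereal m * ereal (c / m) \<le> ereal m * \<bar>V\<bar>"
      using m by (intro ereal_mult_left_mono) auto
    then show ?thesis using m by simp
  qed
  show ?thesis
  proof (rule dense_le)
    fix y assume y: "y < \<bar>U\<bar>"
    show "y \<le> ereal m * \<bar>V\<bar>"
    proof (cases "y \<le> 0")
      case True
      moreover have "0 \<le> ereal m * \<bar>V\<bar>" using m by simp
      ultimately show ?thesis by (rule order_trans)
    next
      case False
      then obtain c where "y = ereal c" "0 < c" using y by (cases y) auto
      moreover have "U < ereal (- c)" using y \<open>\<not> 0 \<le> U\<close> calculation by (cases U) auto
      ultimately show ?thesis using neg by simp
    qed
  qed
qed

lemma ereal_pos_scaled:
  fixes U V :: ereal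
  assumes m: "1 \<le> m"
    and up: "\<And>c. 0 < c \<Longrightarrow> V < ereal c \<Longrightarrow> U \<le> ereal (m * c)"
    and "0 < U"
  shows "0 < V"
proof (rule ccontr)
  assume V: "\<not> 0 < V"
  have "U \<le> 0"
  proof (rule ereal_le_epsilon2)
    fix e :: real assume "0 < e"
    then have "V < ereal (e / m)" "0 < e / m"
      using V m by (auto simp: not_less intro: le_less_trans)
    from up[OF this(2,1)] show "U \<le> 0 + ereal e" using m by simp
  qed
  with assms show False by simp
qed

lemma ereal_neg_scaled:
  fixes U V :: ereal
  assumes m: "1 \<le> m"
    and dn: "\<And>c. 0 < c \<Longrightarrow> U < ereal (- c) \<Longrightarrow> V \<le> ereal (- (c / m))"
    and "U < 0"
  shows "V < 0"
proof -
  obtain r where "U < ereal r" "ereal r < 0" using ereal_dense2[OF \<open>U < 0\<close>] by blast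
  then have "V \<le> ereal (- (- r / m))" using dn[of "- r"] by simp
  also have "\<dots> < 0" using m \<open>ereal r < 0\<close> by (simp add: divide_neg_pos)
  finally show ?thesis .
qed

text \<open>The relation is symmetric: solving for \<open>v\<close> gives the factor 1/\<rho>, again
  between \<open>1 / m\<close> and \<open>m\<close>, and an error that still tends to 0. The
  one-sided bounds therefore apply in both directions.\<close>

lemma Limsup_scaled:
  fixes u v \<rho> e :: "'a \<Rightarrow> real"
  assumes m: "1 \<le> m" and e: "(e \<longlongrightarrow> 0) F"
    and ev: "eventually (\<lambda>x. 1 / m \<le> \<rho> x \<and> \<rho> x \<le> m \<and> u x = \<rho> x * v x + e x) F"
  defines "U \<equiv> Limsup F (\<lambda>x. ereal (u x))" and "V \<equiv> Limsup F (\<lambda>x. ereal (v x))"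
  shows "U > 0 \<and> V > 0 \<or> U < 0 \<and> V < 0 \<or> U = 0 \<and> V = 0"
    and "\<bar>U\<bar> \<le> ereal m * \<bar>V\<bar>"
proof -
  define \<sigma> where "\<sigma> x = 1 / \<rho> x" for x
  define e' where "e' x = - (\<sigma> x * e x)" for x
  have ev_pos: "eventually (\<lambda>x. 0 < \<rho> x) F"
    using ev
  proof eventually_elim
    case (elim x)
    have "0 < 1 / m" using m by simp
    then show ?case using elim by linarith
  qed
  have ev_\<sigma>: "eventually (\<lambda>x. 1 / m \<le> \<sigma> x \<and> \<sigma> x \<le> m) F"
    using ev ev_pos by eventually_elim (use m in \<open>auto simp: \<sigma>_def field_simps\<close>)
  have ev': "eventually (\<lambda>x. 1 / m \<le> \<sigma> x \<and> \<sigma> x \<le> m \<and> v x = \<sigma> x * u x + e' x) F"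
    using ev ev_\<sigma> ev_pos
    by eventually_elim (auto simp: e'_def \<sigma>_def field_simps)
  have lim_e': "(e' \<longlongrightarrow> 0) F"
  proof (rule Lim_null_comparison)
    show "((\<lambda>x. m * \<bar>e x\<bar>) \<longlongrightarrow> 0) F"
      using tendsto_mult_left[OF tendsto_rabs[OF e], of m] by simp
    show "eventually (\<lambda>x. norm (e' x) \<le> m * \<bar>e x\<bar>) F"
      using ev_\<sigma>
    proof eventually_elim
      case (elim x)
      have "0 \<le> 1 / m" using m by simp
      then have "\<bar>\<sigma> x\<bar> \<le> m" using elim by linarith
      then show ?case by (simp add: e'_def abs_mult mult_right_mono)
    qed
  qed
  note uv = Limsup_scaled_bounds[OF m e ev, folded U_def V_def]
  note vu = Limsup_scaled_bounds[OF m lim_e' ev', folded U_def V_def]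
  show "\<bar>U\<bar> \<le> ereal m * \<bar>V\<bar>" using ereal_abs_le_scaled[OF m uv(1) vu(2)] .
  have "0 < U \<Longrightarrow> 0 < V" "0 < V \<Longrightarrow> 0 < U" "U < 0 \<Longrightarrow> V < 0" "V < 0 \<Longrightarrow> U < 0"
    using ereal_pos_scaled[OF m uv(1)] ereal_pos_scaled[OF m vu(1)]
      ereal_neg_scaled[OF m uv(2)] ereal_neg_scaled[OF m vu(2)] by blast+
  then show "U > 0 \<and> V > 0 \<or> U < 0 \<and> V < 0 \<or> U = 0 \<and> V = 0"
    using linorder_less_linear by metis
qed

subsection \<open>Exponents\<close>

lemma nth_le_max_coord: "\<tau> $ i \<le> max_coord \<tau>"
  unfolding max_coord_def by (intro Max_ge) auto

lemma max_coord_le: "(\<And>i. \<tau> $ i \<le> r) \<Longrightarrow> max_coord \<tau> \<le> r"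
  unfolding max_coord_def by (subst Max_le_iff) auto

lemma trace_zero_uminus: "- \<tau> \<in> trace_zero \<longleftrightarrow> \<tau> \<in> trace_zero"
  by (simp add: trace_zero_def sum_negf)

text \<open>On this hyperplane the negated coordinate is the sum of the other d - 1 coordinates;
  this is the source of the factor d - 1.\<close>

lemma uminus_nth_le_max_coord:
  fixes \<tau> :: "real^'n"
  assumes "\<tau> \<in> trace_zero"
  shows "- \<tau> $ i \<le> (real CARD('n) - 1) * max_coord \<tau>"
proof -
  have "\<tau> $ i + (\<Sum>j\<in>UNIV - {i}. \<tau> $ j) = 0"
    using assms by (simp add: trace_zero_def sum.remove[of UNIV i])
  moreover have "(\<Sum>j\<in>UNIV - {i}. \<tau> $ j) \<le> (\<Sum>j\<in>UNIV - {i}. max_coord \<tau>)"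
    by (intro sum_mono nth_le_max_coord)
  moreover have "real (card (UNIV - {i})) = real CARD('n) - 1"
    by (simp add: card_Diff_singleton of_nat_diff)
  ultimately show ?thesis by simp
qed

lemma max_coord_uminus_le:
  fixes \<tau> :: "real^'n"
  assumes "\<tau> \<in> trace_zero"
  shows "max_coord (- \<tau>) \<le> (real CARD('n) - 1) * max_coord \<tau>"
  using uminus_nth_le_max_coord[OF assms] by (intro max_coord_le) simp

text \<open>Positive coordinates are covered since \<open>max_coord \<tau>\<close> is nonnegative
  and the factor is at least 1 for d \<ge> 2.\<close>

lemma infnorm_le_max_coord:
  fixes \<tau> :: "real^'n"
  assumes "CARD('n) \<ge> 2" "\<tau> \<in> trace_zero"
  shows "infnorm \<tau> \<le> (real CARD('n) - 1) * max_coord \<tau>"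
  unfolding infnorm_le_iff_cart
proof
  fix i
  have "0 \<le> (\<Sum>j\<in>(UNIV::'n set). max_coord \<tau>)"
    using assms(2) sum_mono[of UNIV "\<lambda>j. \<tau> $ j" "\<lambda>_. max_coord \<tau>"] nth_le_max_coord[of \<tau>]
    by (simp add: trace_zero_def)
  then have "0 \<le> max_coord \<tau>" by (simp add: zero_le_mult_iff)
  then have "1 * max_coord \<tau> \<le> (real CARD('n) - 1) * max_coord \<tau>"
    using assms(1) by (intro mult_right_mono) auto
  then show "\<bar>\<tau> $ i\<bar> \<le> (real CARD('n) - 1) * max_coord \<tau>"
    using nth_le_max_coord[of \<tau> i] uminus_nth_le_max_coord[OF assms(2), of i] by linarith
qed

section \<open>The filter at infinity on the trace-zero hyperplane\<close>

lemma eventually_trace_zero_at_infinity: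
  "eventually P trace_zero_at_infinity \<longleftrightarrow>
     (\<exists>R. \<forall>\<tau>\<in>trace_zero. R \<le> infnorm \<tau> \<longrightarrow> P \<tau>)"
  unfolding trace_zero_at_infinity_def eventually_inf_principal
    eventually_filtercomap_at_top_linorder by auto

text \<open>Transference evaluates the dual lattice at the opposite point; this invariance lets the
  dual exponents be computed there.\<close>

lemma filtermap_uminus_trace_zero_at_infinity:
  "filtermap uminus trace_zero_at_infinity = (trace_zero_at_infinity :: (real^'n) filter)"
proof -
  have "(\<forall>\<tau>\<in>trace_zero. R \<le> infnorm \<tau> \<longrightarrow> P (- \<tau>)) \<longleftrightarrow>
      (\<forall>\<tau>\<in>trace_zero. R \<le> infnorm \<tau> \<longrightarrow> P \<tau>)" for R and P :: "real^'n \<Rightarrow> bool"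
    by (metis infnorm_neg minus_minus trace_zero_uminus)
  then show ?thesis
    by (simp add: filter_eq_iff eventually_filtermap eventually_trace_zero_at_infinity)
qed

lemma filterlim_max_coord:
  assumes "CARD('n) \<ge> 2"
  shows "filterlim max_coord at_top (trace_zero_at_infinity :: (real^'n) filter)"
  unfolding filterlim_at_top
proof
  fix Z :: real
  have m: "real CARD('n) - 1 > 0" using assms by simp
  have "Z \<le> max_coord \<tau>"
    if "\<tau> \<in> trace_zero" "(real CARD('n) - 1) * Z \<le> infnorm \<tau>" for \<tau> :: "real^'n"
  proof -
    have "(real CARD('n) - 1) * Z \<le> (real CARD('n) - 1) * max_coord \<tau>"
      using infnorm_le_max_coord[OF assms that(1)] that(2) by linarith
    then show ?thesis using m by simp
  qed
  then show "\<forall>\<^sub>F \<tau> :: real^'n in trace_zero_at_infinity. Z \<le> max_coord \<tau>"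
    unfolding eventually_trace_zero_at_infinity by blast
qed

theorem theorem8:
  fixes \<Lambda> :: "(real^'n) set" and k :: nat
  assumes "CARD('n) \<ge> 2"
    and "full_rank_lattice \<Lambda>"
    and "covolume \<Lambda> = 1"
    and "k \<in> {1..CARD('n)}"
  shows "((lower_exponent k \<Lambda> max_coord < 0 \<and>
           upper_exponent (CARD('n) + 1 - k) (dual_lattice \<Lambda>) max_coord > 0) \<or>
          (lower_exponent k \<Lambda> max_coord > 0 \<and>
           upper_exponent (CARD('n) + 1 - k) (dual_lattice \<Lambda>) max_coord < 0) \<or>
          (lower_exponent k \<Lambda> max_coord = 0 \<and>
           upper_exponent (CARD('n) + 1 - k) (dual_lattice \<Lambda>) max_coord = 0)) \<and>
         \<bar>lower_exponent k \<Lambda> max_coord\<bar> \<le>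
           ereal (real CARD('n) - 1) *
           \<bar>upper_exponent (CARD('n) + 1 - k) (dual_lattice \<Lambda>) max_coord\<bar> \<and>
         \<bar>upper_exponent k \<Lambda> max_coord\<bar> \<le>
           ereal (real CARD('n) - 1) *
           \<bar>lower_exponent (CARD('n) + 1 - k) (dual_lattice \<Lambda>) max_coord\<bar>"
proof -
  define l where "l = CARD('n) + 1 - k"
  define F :: "(real^'n) filter" where "F = trace_zero_at_infinity"
  define m where "m = real CARD('n) - 1"
  have m: "1 \<le> m" using assms(1) by (simp add: m_def)
  have kl: "k + l = CARD('n) + 1" "1 \<le> k" "1 \<le> l" using assms(4) by (auto simp: l_def)
  obtain K where K: "\<And>\<tau>. \<bar>log_min k \<Lambda> \<tau> + log_min l (dual_lattice \<Lambda>) (- \<tau>)\<bar> \<le> K"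
    using log_min_transference[OF assms(2) kl] by blast
  \<comment> \<open>With \<open>g\<close> taken at the opposite point,
    \<open>h = - (\<rho> * g) + e\<close> wherever both maximum coordinates are nonzero, and
    \<open>e\<close> tends to 0 because its numerator is bounded by \<open>K\<close>.\<close>
  define h where "h \<tau> = log_min k \<Lambda> \<tau> / max_coord \<tau>" for \<tau>
  define g where "g \<tau> = log_min l (dual_lattice \<Lambda>) (- \<tau>) / max_coord (- \<tau>)" for \<tau>
  define e where "e \<tau> = (log_min k \<Lambda> \<tau> + log_min l (dual_lattice \<Lambda>) (- \<tau>)) / max_coord \<tau>" for \<tau>
  define \<rho> where "\<rho> \<tau> = max_coord (- \<tau>) / max_coord \<tau>" for \<tau> :: "real^'n"
  have lim: "filterlim max_coord at_top F"
    unfolding F_def by (rule filterlim_max_coord[OF assms(1)])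
  then have pos: "eventually (\<lambda>\<tau>. 0 < max_coord \<tau>) F"
    by (rule filterlim_at_top_dense[THEN iffD1, rule_format])
  have tz: "eventually (\<lambda>\<tau>. \<tau> \<in> trace_zero) F"
    unfolding F_def eventually_trace_zero_at_infinity by blast
  have e0: "(e \<longlongrightarrow> 0) F"
  proof (rule Lim_null_comparison)
    show "((\<lambda>\<tau>. K / max_coord \<tau>) \<longlongrightarrow> 0) F"
      using lim by (intro tendsto_divide_0[OF tendsto_const] filterlim_at_top_imp_at_infinity)
    show "eventually (\<lambda>\<tau>. norm (e \<tau>) \<le> K / max_coord \<tau>) F"
      using pos by eventually_elim (use K in \<open>auto simp: e_def abs_divide intro!: divide_right_mono\<close>)
  qed
  have ev: "eventually (\<lambda>\<tau>. 1 / m \<le> \<rho> \<tau> \<and> \<rho> \<tau> \<le> m \<and> h \<tau> = - (\<rho> \<tau> * g \<tau>) + e \<tau>) F"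
    using pos tz
  proof eventually_elim
    case (elim \<tau>)
    \<comment> \<open>Applying the comparison to the point and to its negative places \<rho> between
      \<open>1 / m\<close> and \<open>m\<close>.\<close>
    have 1: "max_coord (- \<tau>) \<le> m * max_coord \<tau>"
      using max_coord_uminus_le[OF elim(2)] by (simp add: m_def)
    have 2: "max_coord \<tau> \<le> m * max_coord (- \<tau>)"
      using max_coord_uminus_le[of "- \<tau>"] elim(2) by (simp add: m_def trace_zero_uminus)
    then have "0 < m * max_coord (- \<tau>)" using elim(1) by linarith
    then have "max_coord (- \<tau>) > 0" using m by (simp add: zero_less_mult_iff)
    then show ?case
      using 1 2 elim(1) m by (auto simp: \<rho>_def h_def g_def e_def field_simps)
  qed
  have up: "upper_exponent l (dual_lattice \<Lambda>) max_coord = Limsup F (\<lambda>\<tau>. ereal (g \<tau>))"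
    unfolding upper_exponent_def g_def F_def
    by (subst filtermap_uminus_trace_zero_at_infinity[symmetric])
      (simp add: Limsup_filtermap_eq)
  have lo: "lower_exponent l (dual_lattice \<Lambda>) max_coord = Liminf F (\<lambda>\<tau>. ereal (g \<tau>))"
    unfolding lower_exponent_def g_def F_def
    by (subst filtermap_uminus_trace_zero_at_infinity[symmetric])
      (simp add: Liminf_filtermap_eq)
  have neg: "Limsup F (\<lambda>\<tau>. ereal (- f \<tau>)) = - Liminf F (\<lambda>\<tau>. ereal (f \<tau>))" for f
    using ereal_Limsup_uminus[of F "\<lambda>\<tau>. ereal (f \<tau>)"] by simp
  \<comment> \<open>The comparison is applied to \<open>- h\<close> and \<open>g\<close>: the upper
    limit of \<open>- h\<close> is minus the lower exponent, so equal signs there mean opposite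
    signs of the exponents.\<close>
  have "((\<lambda>\<tau>. - e \<tau>) \<longlongrightarrow> 0) F" using tendsto_minus[OF e0] by simp
  moreover have "eventually (\<lambda>\<tau>. 1 / m \<le> \<rho> \<tau> \<and> \<rho> \<tau> \<le> m \<and> - h \<tau> = \<rho> \<tau> * g \<tau> + - e \<tau>) F"
    using ev by eventually_elim auto
  ultimately have A: "- lower_exponent k \<Lambda> max_coord > 0 \<and> upper_exponent l (dual_lattice \<Lambda>) max_coord > 0 \<or>
      - lower_exponent k \<Lambda> max_coord < 0 \<and> upper_exponent l (dual_lattice \<Lambda>) max_coord < 0 \<or>
      - lower_exponent k \<Lambda> max_coord = 0 \<and> upper_exponent l (dual_lattice \<Lambda>) max_coord = 0"
      "\<bar>- lower_exponent k \<Lambda> max_coord\<bar> \<le> ereal m * \<bar>upper_exponent l (dual_lattice \<Lambda>) max_coord\<bar>"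
    using Limsup_scaled[OF m, of "\<lambda>\<tau>. - e \<tau>" F \<rho> "\<lambda>\<tau>. - h \<tau>" g]
    unfolding neg up lower_exponent_def F_def[symmetric] h_def[symmetric] by blast+
  \<comment> \<open>For the second inequality the minus sign is moved to \<open>g\<close>, turning
    its upper limit into a lower exponent of the dual.\<close>
  have "eventually (\<lambda>\<tau>. 1 / m \<le> \<rho> \<tau> \<and> \<rho> \<tau> \<le> m \<and> h \<tau> = \<rho> \<tau> * - g \<tau> + e \<tau>) F"
    using ev by eventually_elim auto
  from Limsup_scaled(2)[OF m e0 this]
  have B: "\<bar>upper_exponent k \<Lambda> max_coord\<bar> \<le> ereal m * \<bar>- lower_exponent l (dual_lattice \<Lambda>) max_coord\<bar>"
    unfolding neg lo upper_exponent_def F_def[symmetric] h_def[symmetric] .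
  show ?thesis
    using A B unfolding l_def[symmetric] m_def[symmetric] by (auto simp: ereal_uminus_less_reorder)
qed

end
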